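(* Let $\mathcal{H}$ be a real Hilbert space and assume that $T:\mathcal{H}\to\mathcal{H}$ is a nonexpansive mapping such that $\mathrm{Fix}(T)\neq\emptyset$. Let $\{x^k\}_{k=0}^\infty$ be a sequence generated by the adaptive Halpern iteration (defined in the context), with anchor $u\in\mathcal{H}$ and initial guess $x^0\in\mathcal{H}$ chosen such that $$\varphi_0:=\frac{2\langle x^0-Tx^0,\,u-x^0\rangle}{\|x^0-Tx^0\|^2}>-1,$$ where it is assumed that $x^k\ne Tx^k$ for all $k\ge 0$. Then $$\|x^k-Tx^k\|\le\frac{2}{\varphi_k+1}\|u-x^*\|,\qquad k\ge 1,$$ where $x^*$ is an arbitrary fixed point of $T$. This convergence rate estimate is tight.
   Context: A mapping $T:\mathcal{H}\to\mathcal{H}$ is nonexpansive if $\|Tx-Ty\|\le\|x-y\|$ for all $x,y\in\mathcal{H}$. $\mathrm{Fix}(T)=\{x\in\mathcal{H}: Tx=x\}$ is the set of fixed points of $T$. Adaptive Halpern iteration with anchor $u$ and initial guess $x^0$: for $k\ge 1$, $$x^k=\frac{1}{\varphi_k+1}u+\frac{\varphi_k}{\varphi_k+1}Tx^{k-1},\qquad \varphi_k:=\frac{2\langle x^{k-1}-Tx^{k-1},\,u-x^{k-1}\rangle}{\|x^{k-1}-Tx^{k-1}\|^2}+1.$$ The quantity $\varphi_0$ is defined separately, by the formula in the claim, so that $\varphi_1=\varphi_0+1$. *)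

theory Defs
  imports "HOL-Analysis.Analysis"
begin

definition nonexpansive :: "('a::real_normed_vector \<Rightarrow> 'a) \<Rightarrow> bool" where
  "nonexpansive T \<longleftrightarrow> (\<forall>x y. norm (T x - T y) \<le> norm (x - y))"

definition Fix :: "('a \<Rightarrow> 'a) \<Rightarrow> 'a set" where
  "Fix T = {x. T x = x}"

(* halpern_phi T u x k is the parameter phi_k of the sequence x with anchor u.  For k >= 1 it is
   computed from x (k - 1) and carries the summand 1; phi_0 is computed from x 0 without it, so
   that phi_1 = phi_0 + 1. *)
fun halpern_phi :: "('a::real_inner \<Rightarrow> 'a) \<Rightarrow> 'a \<Rightarrow> (nat \<Rightarrow> 'a) \<Rightarrow> nat \<Rightarrow> real" where
  "halpern_phi T u x 0 = 2 * inner (x 0 - T (x 0)) (u - x 0) / (norm (x 0 - T (x 0)))\<^sup>2"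
| "halpern_phi T u x (Suc k) = 2 * inner (x k - T (x k)) (u - x k) / (norm (x k - T (x k)))\<^sup>2 + 1"

definition adaptive_halpern :: "('a::real_inner \<Rightarrow> 'a) \<Rightarrow> 'a \<Rightarrow> (nat \<Rightarrow> 'a) \<Rightarrow> bool" where
  "adaptive_halpern T u x \<longleftrightarrow>
     (\<forall>k\<ge>1. x k = (1 / (halpern_phi T u x k + 1)) *\<^sub>R u
                + (halpern_phi T u x k / (halpern_phi T u x k + 1)) *\<^sub>R T (x (k - 1)))"

definition halpern_hypotheses ::
    "('a::{real_inner, complete_space} \<Rightarrow> 'a) \<Rightarrow> 'a \<Rightarrow> (nat \<Rightarrow> 'a) \<Rightarrow> bool" where
  "halpern_hypotheses T u x \<longleftrightarrow>
     nonexpansive T \<and> Fix T \<noteq> {} \<and> adaptive_halpern T u x \<and>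
     halpern_phi T u x 0 > -1 \<and> (\<forall>k. x k \<noteq> T (x k))"

(* Tightness: for each index k >= 1 some instance satisfying all the hypotheses attains equality
   at k.  "Some Hilbert space" is made the specific space real^2, because HOL cannot quantify
   existentially over types.  Dimension 1 would not do: there, equality at k forces
   x (k + 1) to be a fixed point, which the hypotheses exclude. *)
definition halpern_rate_tight :: bool where
  "halpern_rate_tight \<longleftrightarrow>
     (\<forall>k\<ge>1. \<exists>(T :: real^2 \<Rightarrow> real^2) u x. \<exists>p\<in>Fix T.
        halpern_hypotheses T u x \<and>
        norm (x k - T (x k)) = 2 / (halpern_phi T u x k + 1) * norm (u - p))"

end

theory Submission
  imports Defs
begin

text \<open>
  Put \<open>r k = x k - T (x k)\<close> and \<open>d = x (k + 1) - x k\<close>. The choice of \<open>\<phi> (k + 1)\<close> is exactly the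
  one for which \<open>norm (d + r k) = norm d\<close>, and with nonexpansiveness at \<open>x k, x (k + 1)\<close> this gives
  \<open>\<phi> (k + 2) \<ge> \<phi> (k + 1) + 1\<close>, that is, \<open>2 \<langle>r k, u - x k\<rangle> \<ge> \<phi> k * (norm (r k))\<^sup>2\<close> for \<open>k \<ge> 1\<close>.
  Adding \<open>2 \<langle>r k, x k - p\<rangle> \<ge> (norm (r k))\<^sup>2\<close>, which is nonexpansiveness at \<open>x k\<close> and the fixed point
  \<open>p\<close>, and applying Cauchy-Schwarz yields the rate.

  For an isometry all these inequalities but Cauchy-Schwarz are equalities. If \<open>T\<close> is linear,
  \<open>\<phi> 0 = 0\<close> and \<open>v = u - r 0\<close>, then \<open>norm v = norm u\<close> and \<open>(j + 1) r j = u - T^j v\<close>, so equality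
  holds at index \<open>k\<close> with \<open>p = 0\<close> iff \<open>T^k v = -u\<close>, whereas no \<open>x j\<close> is fixed iff \<open>T^j v \<noteq> u\<close> for
  all \<open>j\<close>. The plane rotation of order 3 satisfies both with \<open>v = -T^(2k) u\<close>: having odd order,
  none of its powers is \<open>-1\<close>.
\<close>

text \<open>Turns nonexpansiveness into a bound on an inner product, with \<open>b\<close> a
  residual such as \<open>x - T x\<close>.\<close>

lemma norm_diff_le_norm_iff:
  fixes a b :: "'a::real_inner"
  shows "norm (a - b) \<le> norm a \<longleftrightarrow> (norm b)\<^sup>2 \<le> 2 * inner b a"
proof -
  have "norm (a - b) \<le> norm a \<longleftrightarrow> (norm (a - b))\<^sup>2 \<le> (norm a)\<^sup>2"
    by simp
  also have "\<dots> \<longleftrightarrow> (norm b)\<^sup>2 \<le> 2 * inner b a"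
    by (auto simp: power2_norm_eq_inner inner_diff inner_commute)
  finally show ?thesis .
qed

text \<open>As \<open>u - y\<close> is \<open>f\<close> times \<open>d + r\<close>, the bound is
  \<open>f\<close> times \<open>(norm s)\<^sup>2 \<le> 2 * inner s (d + r)\<close>. Asking for
  \<open>f > 0\<close> covers the first step too, where \<open>f = \<phi> 0 + 1\<close> may be less
  than 1.\<close>

lemma halpern_step:
  fixes T :: "'a::real_inner \<Rightarrow> 'a"
  assumes T: "nonexpansive T"
    and ne: "x \<noteq> T x"
    and f: "f = 2 * inner (x - T x) (u - x) / (norm (x - T x))\<^sup>2 + 1" "f > 0"
    and y: "y = (1 / (f + 1)) *\<^sub>R u + (f / (f + 1)) *\<^sub>R T x"
  shows "f * (norm (y - T y))\<^sup>2 \<le> 2 * inner (y - T y) (u - y)"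
proof -
  define r s d where "r = x - T x" and "s = y - T y" and "d = y - x"
  have r: "(norm r)\<^sup>2 \<noteq> 0"
    using ne by (simp add: r_def)
  have ru: "2 * inner r (u - x) = (f - 1) * (norm r)\<^sup>2"
    using f(1) r by (simp add: r_def[symmetric])
  have "(f + 1) *\<^sub>R y = u + f *\<^sub>R T x"
    using \<open>f > 0\<close> by (simp add: y scaleR_right_distrib)
  then have uy: "u - y = f *\<^sub>R (d + r)" and ux: "(f + 1) *\<^sub>R d = (u - x) - f *\<^sub>R r"
    by (simp_all add: r_def d_def algebra_simps)
  have "(f + 1) * (2 * inner r d) = 2 * inner r ((f + 1) *\<^sub>R d)"
    by simp
  also have "\<dots> = 2 * inner r (u - x) - 2 * f * (norm r)\<^sup>2"
    by (simp only: ux inner_diff_right inner_scaleR_right power2_norm_eq_inner) (simp add: algebra_simps)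
  also have "\<dots> = (f + 1) * - (norm r)\<^sup>2"
    unfolding ru by (simp add: algebra_simps)
  finally have "2 * inner r d = - (norm r)\<^sup>2"
    using \<open>f > 0\<close> by (subst (asm) mult_cancel_left) auto
  then have "(norm (d + r))\<^sup>2 = (norm d)\<^sup>2"
    by (simp add: power2_norm_eq_inner inner_add inner_commute)
  then have dr: "norm (d + r) = norm d"
    by simp
  \<comment> \<open>By \<open>dr\<close>, the bound \<open>norm d = norm (y - x)\<close> on
    \<open>T y - T x\<close> can be read as \<open>norm (d + r)\<close>.\<close>
  have "d + r - s = T y - T x"
    by (simp add: d_def r_def s_def)
  then have "norm (d + r - s) \<le> norm (d + r)"
    using T unfolding dr by (simp add: nonexpansive_def d_def)
  then have "(norm s)\<^sup>2 \<le> 2 * inner s (d + r)"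
    by (simp add: norm_diff_le_norm_iff)
  then have "f * (norm s)\<^sup>2 \<le> f * (2 * inner s (d + r))"
    using \<open>f > 0\<close> by simp
  then show ?thesis
    by (simp add: s_def[symmetric] uy)
qed

text \<open>Positivity is a premise here because its proof by induction goes through this
  bound.\<close>

lemma halpern_phi_step:
  assumes H: "halpern_hypotheses T u x" and pos: "halpern_phi T u x (Suc k) > 0"
  shows "halpern_phi T u x (Suc k) * (norm (x (Suc k) - T (x (Suc k))))\<^sup>2
         \<le> 2 * inner (x (Suc k) - T (x (Suc k))) (u - x (Suc k))"
proof (rule halpern_step[where x = "x k"])
  show "nonexpansive T" "x k \<noteq> T (x k)"
    using H by (auto simp: halpern_hypotheses_def)
  show "x (Suc k) = (1 / (halpern_phi T u x (Suc k) + 1)) *\<^sub>R u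
      + (halpern_phi T u x (Suc k) / (halpern_phi T u x (Suc k) + 1)) *\<^sub>R T (x k)"
    using H unfolding halpern_hypotheses_def adaptive_halpern_def
    by (metis diff_Suc_1 le_add1 plus_1_eq_Suc)
qed (use pos in simp_all)

lemma halpern_phi_pos:
  assumes H: "halpern_hypotheses T u x"
  shows "halpern_phi T u x (Suc k) > 0"
proof (induction k)
  case 0
  \<comment> \<open>The hypothesis \<open>\<phi> 0 > -1\<close> says exactly that
    \<open>\<phi> 1 = \<phi> 0 + 1\<close> is positive.\<close>
  then show ?case
    using H by (simp add: halpern_hypotheses_def)
next
  case (Suc k)
  let ?r = "x (Suc k) - T (x (Suc k))"
  have "0 \<le> halpern_phi T u x (Suc k) * (norm ?r)\<^sup>2"
    using Suc by (intro mult_nonneg_nonneg) auto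
  also have "\<dots> \<le> 2 * inner ?r (u - x (Suc k))"
    using H Suc by (rule halpern_phi_step)
  finally have "0 \<le> 2 * inner ?r (u - x (Suc k)) / (norm ?r)\<^sup>2"
    by (intro divide_nonneg_nonneg) auto
  then show ?case
    by (simp only: halpern_phi.simps)
qed

lemma halpern_rate:
  assumes H: "halpern_hypotheses T u x" and k: "k \<ge> 1" and p: "p \<in> Fix T"
  shows "norm (x k - T (x k)) \<le> 2 / (halpern_phi T u x k + 1) * norm (u - p)"
proof -
  obtain j where j: "k = Suc j"
    using k by (cases k) auto
  define r f where "r = x k - T (x k)" and "f = halpern_phi T u x k"
  have T: "nonexpansive T" and nonfix: "x k \<noteq> T (x k)"
    using H by (auto simp: halpern_hypotheses_def)
  have f: "f > 0"
    using halpern_phi_pos[OF H] by (simp add: f_def j del: halpern_phi.simps)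
  have 1: "f * (norm r)\<^sup>2 \<le> 2 * inner r (u - x k)"
    using halpern_phi_step[OF H halpern_phi_pos[OF H]] by (simp only: r_def f_def j)
  have "norm (T (x k) - T p) \<le> norm (x k - p)"
    using T by (simp add: nonexpansive_def)
  then have "norm ((x k - p) - r) \<le> norm (x k - p)"
    using p by (simp add: Fix_def r_def)
  then have 2: "(norm r)\<^sup>2 \<le> 2 * inner r (x k - p)"
    by (simp add: norm_diff_le_norm_iff)
  have "(f + 1) * norm r * norm r \<le> 2 * inner r (u - p)"
    using 1 2 by (simp add: power2_eq_square algebra_simps)
  also have "\<dots> \<le> 2 * norm (u - p) * norm r"
    using norm_cauchy_schwarz[of r "u - p"] by (simp add: mult.commute)
  finally have "(f + 1) * norm r \<le> 2 * norm (u - p)"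
    using nonfix by (simp add: r_def)
  then show ?thesis
    using f by (simp add: r_def f_def[symmetric] field_simps)
qed

text \<open>The iterates are given in closed form and checked against the recursion afterwards. The
  identity \<open>rot\<close> says \<open>T^2 + T + 1 = 0\<close>, hence
  \<open>T^3 = 1\<close>.\<close>

lemma order_three_rate_attained:
  fixes T :: "'a::{real_inner, complete_space} \<Rightarrow> 'a"
  assumes T: "linear T" and isom: "\<And>v. norm (T v) = norm v"
    and rot: "\<And>v. T (T v) = - v - T v" and u: "u \<noteq> 0"
  shows "\<exists>x. halpern_hypotheses T u x \<and>
           norm (x k - T (x k)) = 2 / (halpern_phi T u x k + 1) * norm u"
proof -
  interpret linear T by (rule T)
  \<comment> \<open>In the notation above, \<open>w j = - T^j v\<close>. The shift
    \<open>2 * k\<close> gives \<open>w k = T^(3k) u = u\<close>, so the residual at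
    \<open>k\<close> is parallel to \<open>u\<close>: the equality case of Cauchy-Schwarz.\<close>
  define w where "w j = (T ^^ (j + 2 * k)) u" for j
  \<comment> \<open>Since \<open>(1 - T) (2 + T) = 3\<close>, this choice makes \<open>(j + 1) (x j - T (x j)) = u + w j\<close>.\<close>
  define x where "x j = (1 / (3 * (real j + 1))) *\<^sub>R (2 *\<^sub>R (u + w j) + T (u + w j))" for j
  have w_Suc: "w (Suc j) = T (w j)" for j
    by (simp add: w_def)
  have cube: "(T ^^ (3 * n)) v = v" for n v
    by (induction n) (simp_all add: eval_nat_numeral rot diff neg)
  have isom_pow: "norm ((T ^^ n) v) = norm v" for n v
    by (induction n) (simp_all add: isom)
  \<comment> \<open>If \<open>T^n u = -u\<close>, then three such blocks give
    \<open>T^(3n) u = -u\<close>, against \<open>cube\<close>.\<close>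
  have nonzero: "u + (T ^^ n) u \<noteq> 0" for n
  proof
    assume "u + (T ^^ n) u = 0"
    then have n: "(T ^^ n) u = - u"
      by (simp add: add_eq_0_iff)
    have pow_neg: "(T ^^ n) (- v) = - (T ^^ n) v" for v
      by (induction n) (simp_all add: neg)
    have "(T ^^ (n + n + n)) u = - u"
      by (simp only: funpow_add o_apply n pow_neg minus_minus)
    moreover have "n + n + n = 3 * n"
      by simp
    ultimately have "u = - u"
      using cube[of n u] by (simp only:)
    then have "2 *\<^sub>R u = 0"
      by (simp add: scaleR_2 eq_neg_iff_add_eq_0)
    then show False
      using u by simp
  qed
  have three: "3 *\<^sub>R v = v + v + v" for v :: 'a
    using scaleR_left_distrib[of 2 1 v] by (simp add: scaleR_2)
  have r: "x j - T (x j) = (1 / (real j + 1)) *\<^sub>R (u + w j)" for j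
  proof -
    define c where "c = 1 / (3 * (real j + 1))"
    have "x j - T (x j) = c *\<^sub>R ((2 *\<^sub>R (u + w j) + T (u + w j)) - T (2 *\<^sub>R (u + w j) + T (u + w j)))"
      unfolding x_def c_def[symmetric] by (simp only: scale scaleR_right_diff_distrib)
    also have "(2 *\<^sub>R (u + w j) + T (u + w j)) - T (2 *\<^sub>R (u + w j) + T (u + w j)) = 3 *\<^sub>R (u + w j)"
      unfolding add[of "2 *\<^sub>R _"] scale rot
      by (simp add: three scaleR_2)
    also have "c *\<^sub>R 3 *\<^sub>R (u + w j) = (c * 3) *\<^sub>R (u + w j)"
      by simp
    also have "c * 3 = 1 / (real j + 1)"
      by (simp add: c_def field_simps)
    finally show ?thesis .
  qed
  \<comment> \<open>Equality in the fixed-point inequality at \<open>p = 0\<close>, by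
    isometry.\<close>
  have rx: "2 * inner (x j - T (x j)) (x j) = (norm (x j - T (x j)))\<^sup>2" for j
  proof -
    have "inner (T (x j)) (T (x j)) = inner (x j) (x j)"
      using isom by (simp flip: power2_norm_eq_inner)
    then show ?thesis
      by (simp add: power2_norm_eq_inner inner_diff inner_commute)
  qed
  have ru: "2 * inner (x j - T (x j)) u = (real j + 1) * (norm (x j - T (x j)))\<^sup>2" for j
  proof -
    have "inner (w j) (w j) = inner u u"
      unfolding w_def using isom_pow by (simp flip: power2_norm_eq_inner)
    then have "2 * inner (u + w j) u = (norm (u + w j))\<^sup>2"
      by (simp add: power2_norm_eq_inner inner_add inner_commute)
    then show ?thesis
      unfolding r norm_scaleR inner_scaleR_left
      by (simp add: power_divide) (simp add: power2_eq_square)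
  qed
  have nonfix: "x j \<noteq> T (x j)" for j
    using r[of j] nonzero[of "j + 2 * k"] by (auto simp: w_def)
  have quot: "2 * inner (x j - T (x j)) (u - x j) / (norm (x j - T (x j)))\<^sup>2 = real j" for j
  proof -
    have "2 * inner (x j - T (x j)) (u - x j) = real j * (norm (x j - T (x j)))\<^sup>2"
      using rx[of j] ru[of j] by (simp add: inner_diff_right algebra_simps)
    then show ?thesis
      using nonfix[of j] by simp
  qed
  \<comment> \<open>The summand 1 in \<open>\<phi> (j + 1)\<close> matches the index shift, so the
    weights are those of the classical Halpern iteration.\<close>
  have phi: "halpern_phi T u x j = real j" for j
    by (cases j) (simp_all add: quot)
  have step: "(real j + 2) *\<^sub>R x (Suc j) = u + (real j + 1) *\<^sub>R T (x j)" for j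
  proof -
    have x3: "3 *\<^sub>R (real i + 1) *\<^sub>R x i = 2 *\<^sub>R (u + w i) + T (u + w i)" for i
    proof -
      have "3 * (real i + 1) \<noteq> 0"
        by simp
      then show ?thesis
        unfolding x_def scaleR_scaleR by simp
    qed
    have "(real j + 1) *\<^sub>R T (x j) = (real j + 1) *\<^sub>R x j - (real j + 1) *\<^sub>R (x j - T (x j))"
      by (simp add: algebra_simps)
    also have "\<dots> = (real j + 1) *\<^sub>R x j - (u + w j)"
      unfolding r by simp
    finally have "3 *\<^sub>R (u + (real j + 1) *\<^sub>R T (x j))
        = 3 *\<^sub>R (real j + 1) *\<^sub>R x j - 3 *\<^sub>R w j"
      by (simp only: scaleR_right_distrib scaleR_right_diff_distrib) simp
    \<comment> \<open>Here \<open>rot\<close> enters, as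
      \<open>T (w (Suc j)) = - w j - T (w j)\<close>.\<close>
    also have "\<dots> = 2 *\<^sub>R (u + w (Suc j)) + T (u + w (Suc j))"
      unfolding x3 by (simp add: w_Suc rot add three scaleR_2)
    also have "\<dots> = 3 *\<^sub>R (real j + 2) *\<^sub>R x (Suc j)"
      using x3[of "Suc j"] by (simp add: add.commute)
    finally have "3 *\<^sub>R (real j + 2) *\<^sub>R x (Suc j) = 3 *\<^sub>R (u + (real j + 1) *\<^sub>R T (x j))"
      by (rule sym)
    then show ?thesis
      by (simp only: scaleR_cancel_left) simp
  qed
  have "adaptive_halpern T u x"
    unfolding adaptive_halpern_def phi
  proof (intro allI impI)
    fix i :: nat assume "1 \<le> i"
    then obtain j where i: "i = Suc j"
      by (cases i) auto
    have "x i = (1 / (real j + 2)) *\<^sub>R (real j + 2) *\<^sub>R x (Suc j)"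
      by (simp add: i)
    also have "\<dots> = (1 / (real i + 1)) *\<^sub>R u + (real i / (real i + 1)) *\<^sub>R T (x (i - 1))"
      unfolding step by (simp add: i scaleR_right_distrib add.commute)
    finally show "x i = \<dots>" .
  qed
  moreover have "nonexpansive T"
    unfolding nonexpansive_def by (simp add: isom flip: diff)
  moreover have "Fix T \<noteq> {}"
    using zero by (auto simp: Fix_def intro: exI[of _ 0])
  ultimately have "halpern_hypotheses T u x"
    using nonfix by (simp add: halpern_hypotheses_def phi del: halpern_phi.simps)
  moreover have "w k = u"
    using cube[of k u] by (simp add: w_def)
  then have "norm (x k - T (x k)) = 2 / (halpern_phi T u x k + 1) * norm u"
    unfolding r phi by (simp flip: scaleR_2)
  ultimately show ?thesis
    by blast
qed

text \<open>The rotation by 120 degrees: a primitive cube root of unity satisfies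
  \<open>z^2 + z + 1 = 0\<close>.\<close>

lemma exists_order_three_rotation:
  "\<exists>T :: real^2 \<Rightarrow> real^2. linear T \<and> (\<forall>v. norm (T v) = norm v) \<and> (\<forall>v. T (T v) = - v - T v)"
proof -
  define T :: "real^2 \<Rightarrow> real^2" where
    "T v = vector [- v $ 1 / 2 - sqrt 3 / 2 * v $ 2, sqrt 3 / 2 * v $ 1 - v $ 2 / 2]" for v
  have "linear T"
    by (rule linearI) (simp_all add: T_def vec_eq_iff forall_2 field_simps)
  moreover have "T (T v) = - v - T v" for v
    by (simp add: T_def vec_eq_iff forall_2 field_simps)
  moreover have "norm (T v) = norm v" for v
    unfolding norm_eq
    by (simp add: T_def inner_vec_def sum_2 field_simps)
  ultimately show ?thesis
    by blast
qed

theorem theorem3p3: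
  shows "(\<forall>(T :: 'a::{real_inner, complete_space} \<Rightarrow> 'a) u x.
            halpern_hypotheses T u x \<longrightarrow>
            (\<forall>k\<ge>1. \<forall>p\<in>Fix T.
               norm (x k - T (x k)) \<le> 2 / (halpern_phi T u x k + 1) * norm (u - p)))
         \<and> halpern_rate_tight"
proof
  show "halpern_rate_tight"
    unfolding halpern_rate_tight_def
  proof (intro allI impI)
    fix k :: nat
    obtain T :: "real^2 \<Rightarrow> real^2" where T: "linear T" "\<And>v. norm (T v) = norm v"
        "\<And>v. T (T v) = - v - T v"
      using exists_order_three_rotation by blast
    obtain u :: "real^2" where "u \<noteq> 0"
      using zero_neq_one by blast
    from order_three_rate_attained[OF T this, of k] obtain x where
      "halpern_hypotheses T u x" "norm (x k - T (x k)) = 2 / (halpern_phi T u x k + 1) * norm u"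
      by blast
    moreover have "0 \<in> Fix T"
      using linear_0[OF T(1)] by (simp add: Fix_def)
    ultimately show "\<exists>(T :: real^2 \<Rightarrow> real^2) u x. \<exists>p\<in>Fix T. halpern_hypotheses T u x \<and>
        norm (x k - T (x k)) = 2 / (halpern_phi T u x k + 1) * norm (u - p)"
      by (metis diff_zero)
  qed
qed (use halpern_rate in blast)

end
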